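(* The system $$\dot x_1=x_3-x_2,\qquad \dot x_2=x_1-x_3,\qquad \dot x_3=x_2-x_1$$ is completely integrable, with the two functionally independent first integrals $$I_1=x_1x_2+x_2x_3+x_3x_1,\qquad I_2=x_1+x_2+x_3 .$$
   Context: A first integral of $\dot x=F(x)$ is a function $\Phi$ with $\sum_i F_i\,\partial\Phi/\partial x_i\equiv0$. An $n$-dimensional system is completely integrable if it admits $n-1$ functionally independent first integrals. This system is called the 3-dimensional Karabut system. *)

theory Defs
  imports "HOL-Analysis.Analysis"
begin

definition partial_derivative :: "'n \<Rightarrow> (real ^ 'n \<Rightarrow> real) \<Rightarrow> real ^ 'n::finite \<Rightarrow> real" where
  "partial_derivative i \<Phi> x = frechet_derivative \<Phi> (at x) (axis i 1)"

definition gradient :: "(real ^ 'n \<Rightarrow> real) \<Rightarrow> real ^ 'n::finite \<Rightarrow> real ^ 'n" where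
  "gradient \<Phi> x = (\<chi> i. partial_derivative i \<Phi> x)"

definition C1_function_on :: "(real ^ 'n::finite) set \<Rightarrow> (real ^ 'n \<Rightarrow> real) \<Rightarrow> bool" where
  "C1_function_on U \<Phi> \<longleftrightarrow> (\<forall>x\<in>U. \<Phi> differentiable (at x)) \<and> continuous_on U (gradient \<Phi>)"

definition first_integral ::
  "(real ^ 'n::finite) set \<Rightarrow> (real ^ 'n \<Rightarrow> real ^ 'n) \<Rightarrow> (real ^ 'n \<Rightarrow> real) \<Rightarrow> bool" where
  "first_integral U F \<Phi> \<longleftrightarrow>
     C1_function_on U \<Phi> \<and> (\<forall>x\<in>U. (\<Sum>i\<in>UNIV. F x $ i * partial_derivative i \<Phi> x) = 0)"

(* The library's independence is a property of sets; distinctness makes it linear independence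
   of the family. *)
definition linearly_independent_list :: "'a::real_vector list \<Rightarrow> bool" where
  "linearly_independent_list vs \<longleftrightarrow> distinct vs \<and> independent (set vs)"

(* Functional independence is understood generically: the gradients are linearly independent
   at Lebesgue-almost every point of U (they may become dependent on a null set). *)
definition functionally_independent ::
  "(real ^ 'n::finite) set \<Rightarrow> (real ^ 'n \<Rightarrow> real) list \<Rightarrow> bool" where
  "functionally_independent U \<Phi>s \<longleftrightarrow>
     negligible {x \<in> U. \<not> linearly_independent_list (map (\<lambda>\<Phi>. gradient \<Phi> x) \<Phi>s)}"

definition completely_integrable ::
  "(real ^ 'n::finite) set \<Rightarrow> (real ^ 'n \<Rightarrow> real ^ 'n) \<Rightarrow> bool" where
  "completely_integrable U F \<longleftrightarrow>
     open U \<and> U \<noteq> {} \<and>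
     (\<exists>\<Phi>s. length \<Phi>s = CARD('n) - 1 \<and> (\<forall>\<Phi>\<in>set \<Phi>s. first_integral U F \<Phi>) \<and>
           functionally_independent U \<Phi>s)"

definition karabut3 :: "real ^ 3 \<Rightarrow> real ^ 3" where
  "karabut3 x = vector [x $ 3 - x $ 2, x $ 1 - x $ 3, x $ 2 - x $ 1]"

definition I1 :: "real ^ 3 \<Rightarrow> real" where
  "I1 x = x $ 1 * x $ 2 + x $ 2 * x $ 3 + x $ 3 * x $ 1"

definition I2 :: "real ^ 3 \<Rightarrow> real" where
  "I2 x = x $ 1 + x $ 2 + x $ 3"

end

theory Submission
  imports Defs
begin

text \<open>
  The field \<^const>\<open>karabut3\<close> is the cross product of \<open>(1, 1, 1)\<close> with \<open>x\<close>, so its flow rotates space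
  about the diagonal. Such rotations preserve \<open>|x|\<^sup>2\<close> and the inner product with \<open>(1, 1, 1)\<close>. The
  latter is \<open>I2\<close>, and \<open>2 * I1 = I2\<^sup>2 - |x|\<^sup>2\<close>, so both functions are first integrals. Computationally,
  the field is orthogonal to their gradients, which are \<open>(x\<^sub>2 + x\<^sub>3, x\<^sub>3 + x\<^sub>1, x\<^sub>1 + x\<^sub>2)\<close> for \<open>I1\<close> and
  \<open>(1, 1, 1)\<close> for \<open>I2\<close>; \<open>first_integralI\<close> turns this orthogonality into the definition.

  The two gradients are parallel only where \<open>x\<^sub>1 = x\<^sub>2 = x\<^sub>3\<close>. This diagonal lies inside the plane
  \<open>x\<^sub>1 = x\<^sub>2\<close>, which already has Lebesgue measure zero; off that plane, the comparison of the first
  two components suffices for independence (\<open>linearly_independent_gradients\<close>).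
\<close>

text \<open>
  Frechet derivatives are unique, so a gradient can be read off from any derivative written as an
  inner product.
\<close>

lemma gradient_eqI:
  fixes \<Phi> :: "real ^ 'n::finite \<Rightarrow> real"
  assumes "(\<Phi> has_derivative (\<lambda>h. g \<bullet> h)) (at x)"
  shows "gradient \<Phi> x = g"
  using frechet_derivative_at[OF assms, symmetric]
  by (simp add: gradient_def partial_derivative_def vec_eq_iff inner_axis)

lemma first_integralI:
  fixes \<Phi> :: "real ^ 'n::finite \<Rightarrow> real"
  assumes deriv: "\<And>x. x \<in> U \<Longrightarrow> (\<Phi> has_derivative (\<lambda>h. g x \<bullet> h)) (at x)"
    and cont: "continuous_on U g"
    and orth: "\<And>x. x \<in> U \<Longrightarrow> F x \<bullet> g x = 0"
  shows "first_integral U F \<Phi>"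
proof -
  have grad: "gradient \<Phi> x = g x" if "x \<in> U" for x
    using gradient_eqI[OF deriv[OF that]] .
  have "C1_function_on U \<Phi>"
    unfolding C1_function_on_def
    using deriv cont grad by (auto simp: differentiable_def cong: continuous_on_cong)
  moreover have "(\<Sum>i\<in>UNIV. F x $ i * partial_derivative i \<Phi> x) = 0" if "x \<in> U" for x
  proof -
    have "partial_derivative i \<Phi> x = g x $ i" for i
      using grad[OF that] by (simp add: gradient_def vec_eq_iff)
    then show ?thesis
      using orth[OF that] by (simp add: inner_vec_def)
  qed
  ultimately show ?thesis
    by (simp add: first_integral_def)
qed

definition grad_I1 :: "real ^ 3 \<Rightarrow> real ^ 3" where
  "grad_I1 x = vector [x $ 2 + x $ 3, x $ 3 + x $ 1, x $ 1 + x $ 2]"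

lemma has_derivative_I1: "(I1 has_derivative (\<lambda>h. grad_I1 x \<bullet> h)) (at x)"
  unfolding I1_def[abs_def]
  by (rule derivative_eq_intros bounded_linear.has_derivative[OF bounded_linear_vec_nth]
      has_derivative_ident refl)+
    (simp add: fun_eq_iff grad_I1_def inner_vec_def sum_3 algebra_simps)

lemma has_derivative_I2: "(I2 has_derivative (\<lambda>h. 1 \<bullet> h)) (at x)"
  unfolding I2_def[abs_def]
  by (rule derivative_eq_intros bounded_linear.has_derivative[OF bounded_linear_vec_nth]
      has_derivative_ident refl)+
    (simp add: fun_eq_iff inner_vec_def sum_3)

lemma continuous_on_grad_I1: "continuous_on S grad_I1"
proof -
  have "continuous_on S (\<lambda>x. grad_I1 x $ i)" for i
    using exhaust_3[of i] by (elim disjE) (simp_all add: grad_I1_def continuous_intros)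
  then show ?thesis
    using continuous_on_vec_lambda[of S "\<lambda>i x. grad_I1 x $ i"] by simp
qed

lemma first_integral_I1: "first_integral UNIV karabut3 I1"
  by (rule first_integralI[OF has_derivative_I1 continuous_on_grad_I1])
    (simp add: karabut3_def grad_I1_def inner_vec_def sum_3 algebra_simps)

lemma first_integral_I2: "first_integral UNIV karabut3 I2"
  by (rule first_integralI[OF has_derivative_I2 continuous_on_const])
    (simp add: karabut3_def inner_vec_def sum_3)

text \<open>
  The first two components of the gradient of \<open>I1\<close> differ by \<open>x\<^sub>2 - x\<^sub>1\<close>, whereas all components of a
  multiple of \<open>(1, 1, 1)\<close> agree.
\<close>

lemma linearly_independent_gradients:
  assumes "x $ 1 \<noteq> x $ 2"
  shows "linearly_independent_list [gradient I1 x, gradient I2 x]"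
proof -
  have "grad_I1 x \<noteq> c *\<^sub>R 1" for c
  proof
    assume "grad_I1 x = c *\<^sub>R 1"
    then have "grad_I1 x $ 1 = grad_I1 x $ 2"
      by simp
    with assms show False
      by (simp add: grad_I1_def)
  qed
  then have notin: "grad_I1 x \<notin> span {1}"
    by (auto simp: span_singleton)
  moreover have "grad_I1 x \<noteq> 1"
    using notin by (auto simp: span_base)
  moreover have "(1 :: real ^ 3) \<noteq> 0"
    by (simp add: vec_eq_iff)
  ultimately show ?thesis
    by (simp add: linearly_independent_list_def independent_insert
        gradient_eqI[OF has_derivative_I1] gradient_eqI[OF has_derivative_I2])
qed

lemma functionally_independent_I1_I2: "functionally_independent UNIV [I1, I2]"
  unfolding functionally_independent_def
proof (rule negligible_subset)
  let ?a = "axis 1 1 - axis 2 1 :: real ^ 3"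
  have "?a $ 1 = 1"
    by (simp add: axis_def)
  then have "?a \<noteq> 0"
    by (metis zero_index zero_neq_one)
  then show "negligible {x. ?a \<bullet> x = 0}"
    by (intro negligible_hyperplane) simp
  show "{x \<in> UNIV. \<not> linearly_independent_list (map (\<lambda>\<Phi>. gradient \<Phi> x) [I1, I2])}
      \<subseteq> {x. ?a \<bullet> x = 0}"
    using linearly_independent_gradients by (auto simp: inner_diff_left inner_axis')
qed

theorem proposition2:
  "completely_integrable UNIV karabut3 \<and>
   first_integral UNIV karabut3 I1 \<and>
   first_integral UNIV karabut3 I2 \<and>
   functionally_independent UNIV [I1, I2]"
proof -
  have "completely_integrable UNIV karabut3"
    unfolding completely_integrable_def
    using first_integral_I1 first_integral_I2 functionally_independent_I1_I2
    by (auto intro!: exI[of _ "[I1, I2]"])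
  then show ?thesis
    using first_integral_I1 first_integral_I2 functionally_independent_I1_I2 by blast
qed

end
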